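(* Let $n,m\in\mathbb{N}=\{0,1,2,3,\ldots\}$. Then $$e^{-x^3}P_{n,n+m}(x)=\frac{(-1)^n}{3^n}\frac{d^n}{dx^n}\left(e^{-x^3}P_{0,m}(x)\right),$$ $$e^{-x^3}P_{n+m,n}(x)=\frac{(-1)^n}{3^n}\frac{d^n}{dx^n}\left(e^{-x^3}P_{m,0}(x)\right).$$
   Context: Let $\omega=e^{2\pi i/3}$ and, for $k=0,1,2$, let $\Gamma_k=\{r\omega^k: r\ge 0\}$ be the closed ray in $\mathbb{C}$ from the origin in direction $\omega^k$. All rays are oriented from left to right, so $\Gamma_0$ goes from $0$ to $+\infty$, while $\Gamma_1,\Gamma_2$ go from infinity to $0$. Thus for $j=1,2$ $$\int_{\Gamma_0\cup\Gamma_j} f(x)\,dx=\int_0^\infty f(t)\,dt-\omega^j\int_0^\infty f(\omega^j t)\,dt .$$ For $(k,l)\in\mathbb{N}^2$, $P_{k,l}$ is the monic polynomial of degree $k+l$ satisfying $$\int_{\Gamma_0\cup\Gamma_1}x^iP_{k,l}(x)e^{-x^3}dx=0,\quad i=0,1,\ldots,k-1,$$ $$\int_{\Gamma_0\cup\Gamma_2}x^iP_{k,l}(x)e^{-x^3}dx=0,\quad i=0,1,\ldots,l-1.$$ Standing assumption: for every $(k,l)\in\mathbb{N}^2$ there is exactly one such monic polynomial of degree $k+l$. In particular $P_{m,0}$ and $P_{0,m}$ are the usual monic orthogonal polynomials of degree $m$ for the weight $e^{-x^3}$ on $\Gamma_0\cup\Gamma_1$ and $\Gamma_0\cup\Gamma_2$,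 respectively. *)

theory Defs
  imports "HOL-Analysis.Analysis" "HOL-Computational_Algebra.Polynomial"
begin

definition \<omega> :: complex where
  "\<omega> = exp (2 * of_real pi * \<i> / 3)"

text \<open>The rays with index 1 and 2 are traversed from infinity to the origin, whence the minus
  sign.\<close>
definition rays_integral :: "nat \<Rightarrow> (complex \<Rightarrow> complex) \<Rightarrow> complex" where
  "rays_integral j f =
     (LINT t:{0..}|lborel. f (of_real t)) - \<omega> ^ j * (LINT t:{0..}|lborel. f (\<omega> ^ j * of_real t))"

definition mop :: "nat \<Rightarrow> nat \<Rightarrow> complex poly \<Rightarrow> bool" where
  "mop k l p \<longleftrightarrow>
     degree p = k + l \<and> lead_coeff p = 1 \<and>
     (\<forall>i<k. rays_integral 1 (\<lambda>x. x ^ i * poly p x * exp (- (x ^ 3))) = 0) \<and>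
     (\<forall>i<l. rays_integral 2 (\<lambda>x. x ^ i * poly p x * exp (- (x ^ 3))) = 0)"

text \<open>Meaningful only when exactly one polynomial satisfies \<open>mop k l\<close>.\<close>
definition P :: "nat \<Rightarrow> nat \<Rightarrow> complex poly" where
  "P k l = (THE p. mop k l p)"

end

theory Submission
  imports Defs "HOL-Probability.Distributions"
begin

text \<open>Put \<open>T q = x\<^sup>2 q - q'/3\<close>, so that \<open>(e\<^bsup>-x^3\<^esup> q)' = -3 e\<^bsup>-x^3\<^esup> T q\<close>. On each of
  the three rays the integral of this derivative is \<open>- q(0)\<close>, so the contributions of two rays
  cancel, and integration by parts shows that the moment of \<open>x\<^sup>i T q\<close> is \<open>i/3\<close> times that of
  \<open>x\<^bsup>i-1\<^esup> q\<close>. Hence \<open>T\<close> raises both orders of orthogonality by one, and the claim follows from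
  uniqueness.\<close>

text \<open>Domination by a multiple of the ordinary exponential gives decay and integrability at
  once. The factor \<open>exp 1\<close> pays for the interval (0,1), where t^3 lies below t.\<close>

lemma power_exp_neg_cube_le:
  fixes t :: real
  assumes "0 \<le> t"
  shows "t ^ k * exp (- (t ^ 3)) \<le> exp 1 * (t ^ k * exp (- t))"
proof -
  have "t - 1 \<le> t ^ 3"
  proof (cases "t \<le> 1")
    case True
    then show ?thesis using assms zero_le_power[of t 3] by linarith
  next
    case False
    then show ?thesis using self_le_power[of t 3] by simp
  qed
  then have "exp (- (t ^ 3)) \<le> exp (1 + (- t))" by simp
  then have "exp (- (t ^ 3)) \<le> exp 1 * exp (- t)" by (simp only: exp_add)
  then show ?thesis
    using mult_left_mono[of "exp (- (t ^ 3))" "exp 1 * exp (- t)" "t ^ k"] assms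
    by (simp add: mult_ac)
qed

lemma power_exp_neg_cube_tendsto_0:
  "((\<lambda>t::real. t ^ k * exp (- (t ^ 3))) \<longlongrightarrow> 0) at_top"
proof (rule tendsto_sandwich)
  show "\<forall>\<^sub>F t::real in at_top. t ^ k * exp (- (t ^ 3)) \<le> exp 1 * (t ^ k * exp (- t))"
    using eventually_ge_at_top[of 0] by eventually_elim (rule power_exp_neg_cube_le)
  show "\<forall>\<^sub>F t::real in at_top. 0 \<le> t ^ k * exp (- (t ^ 3))"
    using eventually_ge_at_top[of 0] by eventually_elim simp
  show "((\<lambda>t::real. exp 1 * (t ^ k * exp (- t))) \<longlongrightarrow> 0) at_top"
    using tendsto_mult_right_zero[OF tendsto_power_div_exp_0[of k], of "exp 1"]
    by (simp add: exp_minus field_simps)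
qed simp

lemma power_exp_neg_cube_integrable:
  "set_integrable lborel {0..} (\<lambda>t::real. t ^ k * exp (- (t ^ 3)))"
proof -
  have "set_integrable lborel {0..} (\<lambda>t::real. t ^ k * exp (- t))"
    unfolding set_integrable_def
  proof (rule integrableI_nonneg)
    \<comment> \<open>This is the Gamma integral with value \<open>fact k\<close>, hence
      finite.\<close>
    have "(\<integral>\<^sup>+t. ennreal (indicator {0..} t *\<^sub>R (t ^ k * exp (- t))) \<partial>lborel) =
        (\<integral>\<^sup>+t. ennreal (t ^ k * exp (- t)) * indicator {0..} t \<partial>lborel)"
      by (intro nn_integral_cong) (auto split: split_indicator)
    then show "(\<integral>\<^sup>+t. ennreal (indicator {0..} t *\<^sub>R (t ^ k * exp (- t))) \<partial>lborel) < \<infinity>"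
      by (simp only: nn_intergal_power_times_exp_Ici ennreal_less_top infinity_ennreal_def)
  qed (auto split: split_indicator)
  then have "set_integrable lborel {0..} (\<lambda>t::real. exp 1 * (t ^ k * exp (- t)))"
    by simp
  then show ?thesis
    by (rule set_integrable_bound)
       (use power_exp_neg_cube_le in \<open>auto simp: set_borel_measurable_def abs_mult\<close>)
qed

lemma poly_exp_neg_cube_tendsto_0:
  fixes c :: complex
  assumes "c ^ 3 = 1"
  shows "((\<lambda>t::real. poly q (c * of_real t) * exp (- ((c * of_real t) ^ 3))) \<longlongrightarrow> 0) at_top"
proof -
  \<comment> \<open>Since \<open>c ^ 3 = 1\<close>, the weight on the ray is the real function
    exp(-t^3). The power t^k makes the induction work: passing from q to a + x q uses the hypothesis
    at \<open>Suc k\<close>.\<close>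
  have "((\<lambda>t. of_real (t ^ k * exp (- (t ^ 3))) * poly q (c * of_real t)) \<longlongrightarrow> 0) at_top" for k
  proof (induction q arbitrary: k)
    case (pCons a q)
    have "((\<lambda>t. a * of_real (t ^ k * exp (- (t ^ 3)))
        + c * (of_real (t ^ Suc k * exp (- (t ^ 3))) * poly q (c * of_real t))) \<longlongrightarrow>
        a * of_real 0 + c * 0) at_top"
      by (intro tendsto_intros power_exp_neg_cube_tendsto_0 pCons)
    then show ?case by (simp add: algebra_simps)
  qed simp
  from this[of 0] show ?thesis
    by (simp add: power_mult_distrib assms exp_of_real[symmetric] mult_ac)
qed

lemma poly_exp_neg_cube_integrable:
  fixes c :: complex
  assumes "c ^ 3 = 1"
  shows "set_integrable lborel {0..}
    (\<lambda>t. poly q (c * of_real t) * exp (- ((c * of_real t) ^ 3)))"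
proof -
  have of_real_int: "set_integrable lborel {0..} (\<lambda>t. complex_of_real (t ^ k * exp (- (t ^ 3))))"
    for k
    using integrable_of_real[OF power_exp_neg_cube_integrable[of k, unfolded set_integrable_def]]
    by (simp add: set_integrable_def scaleR_conv_of_real)
  have "set_integrable lborel {0..}
      (\<lambda>t. of_real (t ^ k * exp (- (t ^ 3))) * poly q (c * of_real t))" for k
  proof (induction q arbitrary: k)
    case 0
    then show ?case by (simp add: set_integrable_def)
  next
    case (pCons a q)
    have "set_integrable lborel {0..} (\<lambda>t. a * of_real (t ^ k * exp (- (t ^ 3)))
        + c * (of_real (t ^ Suc k * exp (- (t ^ 3))) * poly q (c * of_real t)))"
      by (intro set_integral_add set_integrable_mult_right pCons of_real_int)
    then show ?case by (simp add: algebra_simps)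
  qed
  from this[of 0] show ?thesis
    by (simp add: power_mult_distrib assms exp_of_real[symmetric] mult_ac)
qed

text \<open>The operator \<open>T\<close> from above. Splitting off the factor -3 from the
  derivative makes it preserve leading coefficients, so monic polynomials stay monic.\<close>

definition weight_raise :: "complex poly \<Rightarrow> complex poly" where
  "weight_raise q = monom 1 2 * q - smult (1 / 3) (pderiv q)"

lemma has_field_derivative_exp_neg_cube_poly:
  "((\<lambda>z. exp (- (z ^ 3)) * poly q z) has_field_derivative
     - 3 * (exp (- (z ^ 3)) * poly (weight_raise q) z)) (at z)"
  by (auto intro!: derivative_eq_intros
      simp: weight_raise_def poly_monom algebra_simps power2_eq_square)

lemma deriv_funpow_exp_neg_cube_poly:
  "(deriv ^^ n) (\<lambda>z. exp (- (z ^ 3)) * poly q z) =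
     (\<lambda>z. (- 3) ^ n * (exp (- (z ^ 3)) * poly ((weight_raise ^^ n) q) z))"
proof (induction n)
  case (Suc n)
  show ?case
    unfolding funpow.simps comp_def Suc
  proof (rule ext, rule DERIV_imp_deriv)
    fix z :: complex
    show "((\<lambda>z. (- 3) ^ n * (exp (- (z ^ 3)) * poly ((weight_raise ^^ n) q) z))
        has_field_derivative (- 3) ^ Suc n *
          (exp (- (z ^ 3)) * poly (weight_raise ((weight_raise ^^ n) q)) z)) (at z)"
      using DERIV_cmult[OF has_field_derivative_exp_neg_cube_poly, of "(- 3) ^ n"
          "(weight_raise ^^ n) q" z]
      by (simp only: power_Suc mult_ac)
  qed
qed simp

text \<open>The outer \<open>c\<close> comes from dx = c dt. The integrand is a multiple of a
  derivative along the ray and decays at infinity, so only the value at the origin survives; it does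
  not depend on the ray.\<close>

lemma ray_integral_weight_raise:
  assumes c: "c ^ 3 = 1"
  shows "c * (LINT t:{0..}|lborel.
      poly (weight_raise q) (c * of_real t) * exp (- ((c * of_real t) ^ 3))) = poly q 0 / 3"
proof -
  define F where "F t = poly q (c * of_real t) * exp (- ((c * of_real t) ^ 3))" for t :: real
  define g where
    "g t = poly (weight_raise q) (c * of_real t) * exp (- ((c * of_real t) ^ 3))" for t :: real
  have deriv: "(F has_vector_derivative - 3 * c * g t) (at t)" for t
  proof -
    have "((\<lambda>z. c * z) \<circ> of_real has_vector_derivative c) (at t)"
      unfolding comp_def
      by (auto intro!: derivative_eq_intros)
    from field_vector_diff_chain_at[OF this, of "\<lambda>z. exp (- (z ^ 3)) * poly q z",
        OF has_field_derivative_exp_neg_cube_poly]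
    show ?thesis by (simp add: F_def[abs_def] g_def comp_def mult_ac)
  qed
  have int: "set_integrable lborel {0..} g"
    unfolding g_def using c by (rule poly_exp_neg_cube_integrable)
  \<comment> \<open>The fundamental theorem is applied on the open half-line, whereas
    \<open>rays_integral\<close> uses the closed one; the two differ by the null set {0}.\<close>
  have int': "set_integrable lborel {0<..} g"
    using int by (rule set_integrable_subset) auto
  have "(LBINT t=ereal 0..\<infinity>. - 3 * c * g t) = 0 - poly q 0"
  proof (rule interval_integral_FTC_integrable)
    show "isCont (\<lambda>t. - 3 * c * g t) t" for t
      unfolding g_def by (intro continuous_intros)
    have "{0<..} = einterval (ereal 0) \<infinity>" by (auto simp: einterval_iff)
    then show "set_integrable lborel (einterval (ereal 0) \<infinity>) (\<lambda>t. - 3 * c * g t)"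
      using set_integrable_mult_right[OF int', of "- 3 * c"] by simp
    have "isCont F 0" unfolding F_def by (intro continuous_intros)
    then have "(F \<longlongrightarrow> poly q 0) (at_right 0)"
      by (auto simp: F_def isCont_def intro: tendsto_mono[OF at_le])
    then show "((F \<circ> real_of_ereal) \<longlongrightarrow> poly q 0) (at_right (ereal 0))"
      by (simp add: ereal_tendsto_simps)
    show "((F \<circ> real_of_ereal) \<longlongrightarrow> 0) (at_left \<infinity>)"
      using poly_exp_neg_cube_tendsto_0[OF c] by (simp add: ereal_tendsto_simps F_def[abs_def])
  qed (use deriv in auto)
  moreover have "(LINT t:{0<..}|lborel. g t) = (LINT t:{0..}|lborel. g t)"
  proof (rule set_integral_cong_set)
    show "set_borel_measurable lborel {0..} g" "set_borel_measurable lborel {0<..} g"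
      using int int' unfolding set_integrable_def set_borel_measurable_def
      by (auto dest: borel_measurable_integrable)
    show "AE t in lborel. t \<in> {0..} \<longleftrightarrow> t \<in> {0::real<..}"
      using AE_lborel_singleton[of "0::real"] by eventually_elim auto
  qed
  ultimately have "- 3 * c * (LINT t:{0..}|lborel. g t) = - poly q 0"
    using set_integral_mult_right[of lborel "{0<..}" "- 3 * c" g]
    by (simp only: interval_integral_to_infinity_eq diff_0)
  then show ?thesis by (simp add: g_def field_simps)
qed

text \<open>A linear functional on polynomials: the powers x^i of the orthogonality conditions are
  absorbed into the argument as \<open>monom 1 i\<close>.\<close>

definition moment :: "nat \<Rightarrow> complex poly \<Rightarrow> complex" where
  "moment j q = rays_integral j (\<lambda>x. poly q x * exp (- (x ^ 3)))"

lemma omega_power_cube: "(\<omega> ^ j) ^ 3 = 1"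
proof -
  have "\<omega> ^ 3 = 1"
    using exp_two_pi_i unfolding \<omega>_def exp_of_nat_mult[symmetric] by (simp add: mult_ac)
  then show ?thesis by (metis mult.commute power_mult power_one)
qed

lemma moment_add: "moment j (p + q) = moment j p + moment j q"
proof -
  have "(LINT t:{0..}|lborel.
        poly (p + q) (\<omega> ^ i * of_real t) * exp (- ((\<omega> ^ i * of_real t) ^ 3))) =
      (LINT t:{0..}|lborel. poly p (\<omega> ^ i * of_real t) * exp (- ((\<omega> ^ i * of_real t) ^ 3))) +
      (LINT t:{0..}|lborel. poly q (\<omega> ^ i * of_real t) * exp (- ((\<omega> ^ i * of_real t) ^ 3)))"
    for i
    unfolding poly_add distrib_right
    by (intro set_integral_add poly_exp_neg_cube_integrable omega_power_cube)
  \<comment> \<open>The instance 0 is the positive half-line, as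
    \<open>\<omega> ^ 0 = 1\<close>.\<close>
  from this[of 0] this[of j] show ?thesis
    by (simp add: moment_def rays_integral_def distrib_left del: poly_add)
qed

lemma moment_smult: "moment j (smult a q) = a * moment j q"
  by (simp add: moment_def rays_integral_def mult.assoc right_diff_distrib)

lemma moment_weight_raise: "moment j (weight_raise q) = 0"
  using ray_integral_weight_raise[OF omega_power_cube[of 0], of q]
    ray_integral_weight_raise[OF omega_power_cube[of j], of q]
  by (simp add: moment_def rays_integral_def del: eq_divide_eq_numeral1)

text \<open>By the product rule x^i T q = T (x^i q) + (i/3) x^(i-1) q, and the first summand has
  moment zero. For \<open>i = 0\<close> the truncated \<open>i - 1\<close> is harmless because its
  coefficient vanishes.\<close>

lemma moment_monom_mult_weight_raise:
  "moment j (monom 1 i * weight_raise q) = of_nat i / 3 * moment j (monom 1 (i - 1) * q)"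
proof -
  have "monom (of_nat i) (i - 1) = smult (of_nat i) (monom 1 (i - 1) :: complex poly)"
    by (simp add: smult_monom)
  then have pderiv: "pderiv (monom 1 i * q) =
      monom 1 i * pderiv q + smult (of_nat i) (monom 1 (i - 1) * q)"
    by (simp add: pderiv_mult pderiv_monom mult.commute)
  have "monom 1 i * weight_raise q =
      weight_raise (monom 1 i * q) + smult (of_nat i / 3) (monom 1 (i - 1) * q)"
    unfolding weight_raise_def pderiv
    by (simp add: right_diff_distrib smult_add_right mult.left_commute)
  then show ?thesis by (simp add: moment_add moment_smult moment_weight_raise)
qed

lemma mop_iff_moment:
  "mop k l p \<longleftrightarrow> degree p = k + l \<and> lead_coeff p = 1 \<and>
     (\<forall>i<k. moment 1 (monom 1 i * p) = 0) \<and> (\<forall>i<l. moment 2 (monom 1 i * p) = 0)"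
  by (simp add: mop_def moment_def poly_monom)

text \<open>The term x^2 q dominates: the derivative has smaller degree and cannot affect the top
  coefficient.\<close>

lemma degree_weight_raise:
  assumes "q \<noteq> 0"
  shows "degree (weight_raise q) = degree q + 2"
    and "lead_coeff (weight_raise q) = lead_coeff q"
proof -
  have deg: "degree (monom 1 2 * q) = degree q + 2"
    using assms by (simp add: degree_mult_eq degree_monom_eq)
  have less: "degree (- smult (1 / 3) (pderiv q)) < degree (monom 1 2 * q)"
    unfolding deg by (simp add: degree_pderiv)
  have eq: "weight_raise q = - smult (1 / 3) (pderiv q) + monom 1 2 * q"
    by (simp add: weight_raise_def)
  show "degree (weight_raise q) = degree q + 2"
    unfolding eq degree_add_eq_right[OF less] by (rule deg)
  show "lead_coeff (weight_raise q) = lead_coeff q"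
    unfolding eq lead_coeff_add_le[OF less] by (simp add: lead_coeff_mult degree_monom_eq)
qed

text \<open>Condition \<open>Suc i\<close> for T p reduces to condition \<open>i\<close> for p, and
  condition 0 holds by the factor i/3. Each family thus gains one condition, in step with the
  degree, which grows by two.\<close>

lemma mop_weight_raise:
  assumes "mop k l p"
  shows "mop (Suc k) (Suc l) (weight_raise p)"
proof -
  have "p \<noteq> 0" using assms by (auto simp: mop_def)
  then show ?thesis
    using assms degree_weight_raise[of p]
    by (auto simp: mop_iff_moment moment_monom_mult_weight_raise less_Suc_eq_0_disj)
qed

lemma mop_weight_raise_funpow:
  "mop k l p \<Longrightarrow> mop (n + k) (n + l) ((weight_raise ^^ n) p)"
  by (induction n) (auto intro: mop_weight_raise)

theorem theorem1p2:
  fixes n m :: nat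
  assumes unique: "\<forall>k l. \<exists>!p. mop k l p"
  shows "(\<forall>x::complex. exp (- (x ^ 3)) * poly (P n (n + m)) x =
            (- 1) ^ n / 3 ^ n * (deriv ^^ n) (\<lambda>z. exp (- (z ^ 3)) * poly (P 0 m) z) x) \<and>
         (\<forall>x::complex. exp (- (x ^ 3)) * poly (P (n + m) n) x =
            (- 1) ^ n / 3 ^ n * (deriv ^^ n) (\<lambda>z. exp (- (z ^ 3)) * poly (P m 0) z) x)"
proof -
  have mop_P: "mop k l (P k l)" for k l
    unfolding P_def using unique by (blast intro: theI')
  \<comment> \<open>Both sides satisfy \<open>mop (n + k) (n + l)\<close>, so uniqueness identifies
    them. The two identities are the cases (0, m) and (m, 0).\<close>
  have P_raise: "P (n + k) (n + l) = (weight_raise ^^ n) (P k l)" for k l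
    using mop_P mop_weight_raise_funpow[OF mop_P] unique by blast
  \<comment> \<open>The prefactor undoes the -3 produced by each of the n differentiations.\<close>
  have "(- 1) ^ n / 3 ^ n * (- 3) ^ n = (1 :: complex)"
    by (simp add: power_mult_distrib[symmetric] power_divide[symmetric])
  then show ?thesis
    using P_raise[of 0 m] P_raise[of m 0]
    by (simp add: deriv_funpow_exp_neg_cube_poly mult.assoc[symmetric])
qed

end
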